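(* Let $\varepsilon>0$. There exists $n_0=n_0(\varepsilon)$ such that the following holds for all integers $n,k,s$ with $n\ge n_0$, $s\ge 1$ and $n>(2+\varepsilon)k^2+s$: if $\mathcal F\subset\binom{[n]}{k}$ is a union of $s$ intersecting families, then $|\mathcal F|\le\binom{n}{k}-\binom{n-s}{k}$. Moreover, equality is possible only if $\mathcal F$ is a union of $s$ stars, i.e. $\mathcal F=\bigcup_{i=1}^s\{F\in\binom{[n]}{k}:x_i\in F\}$ for some distinct $x_1,\dots,x_s\in[n]$.
   Context: $[n]=\{1,\dots,n\}$ and $\binom{[n]}{k}$ is the set of $k$-element subsets of $[n]$. A family $\mathcal F$ is intersecting if $A\cap B\ne\emptyset$ for all $A,B\in\mathcal F$. A star with center $x$ is the family $\mathcal S_x=\{F\in\binom{[n]}{k}:x\in F\}$. *)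

theory Defs
  imports Complex_Main "HOL-Library.Ramsey"
begin

text \<open>The case \<open>A = B\<close> is included, so an intersecting family never contains the empty set;
  the empty family is intersecting.\<close>
definition intersecting :: "'a set set \<Rightarrow> bool" where
  "intersecting F \<longleftrightarrow> (\<forall>A\<in>F. \<forall>B\<in>F. A \<inter> B \<noteq> {})"

definition star :: "nat \<Rightarrow> nat \<Rightarrow> nat \<Rightarrow> nat set set" where
  "star n k x = {F \<in> nsets {1..n} k. x \<in> F}"

text \<open>The members of the union are indexed, so they may overlap, coincide or be empty.\<close>
definition union_of_intersecting :: "nat \<Rightarrow> 'a set set \<Rightarrow> bool" where
  "union_of_intersecting s F \<longleftrightarrow>
     (\<exists>G :: nat \<Rightarrow> 'a set set. (\<forall>i\<in>{1..s}. intersecting (G i)) \<and> F = (\<Union>i\<in>{1..s}. G i))"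

definition union_of_stars :: "nat \<Rightarrow> nat \<Rightarrow> nat \<Rightarrow> nat set set \<Rightarrow> bool" where
  "union_of_stars n k s F \<longleftrightarrow>
     (\<exists>x :: nat \<Rightarrow> nat. inj_on x {1..s} \<and> x ` {1..s} \<subseteq> {1..n} \<and> F = (\<Union>i\<in>{1..s}. star n k (x i)))"

end

theory Submission
  imports Defs
begin

text \<open>
  Let \<open>m = n - s\<close>. If some member of the union is contained in a star, delete the centre and that
  member: \<open>m\<close> does not change. So let all members be non-trivial; then the number of uncovered
  \<open>k\<close>-sets has to exceed \<open>m choose k\<close>. The sets containing no member of the union form a down-set \<open>D\<close>,
  which is the intersection of the down-sets belonging to the \<open>s\<close> intersecting families. In the \<open>p\<close>-biased measure
  Harris' inequality gives \<open>\<mu>(D) \<ge> (1 - q)\<^sup>s\<close>, where \<open>q\<close> bounds the measure of the up-set generated by a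
  non-trivial intersecting family, and \<open>q \<le> p (1 - \<eta>)\<close> with \<open>\<eta>\<close> exponentially small in \<open>k\<close>.
  If at most \<open>m choose k\<close> sets of size \<open>k\<close> were uncovered, then by Kruskal--Katona at most
  \<open>m choose j\<close> sets of size \<open>j\<close> would lie in \<open>D\<close> for every \<open>j \<ge> k\<close>, and \<open>\<mu>(D)\<close> would exceed the value
  \<open>(1 - p)\<^sup>s\<close> attained by \<open>s\<close> stars only through the levels below \<open>k\<close>. That contribution
  is too small when \<open>m > 2 k\<^sup>2\<close> and \<open>p\<close> is constant.
\<close>

section \<open>Biased measures on a finite power set\<close>

text \<open>Expectation of \<open>f R\<close> when \<open>R\<close> contains each point of
  \<open>V\<close> independently with probability \<open>p\<close>. The measure of a family is the
  expectation of its indicator \<open>of_bool\<close>.\<close>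

definition expect :: "real \<Rightarrow> 'a set \<Rightarrow> ('a set \<Rightarrow> real) \<Rightarrow> real" where
  "expect p V f = (\<Sum>R\<in>Pow V. p ^ card R * (1 - p) ^ card (V - R) * f R)"

lemma expect_empty [simp]: "expect p {} f = f {}"
  by (simp add: expect_def)

text \<open>Conditioning on whether \<open>x\<close> lies in the random set. The later inductions
  that evaluate or bound \<open>expect\<close> rest on this split.\<close>

lemma expect_insert:
  assumes "finite V" "x \<notin> V"
  shows "expect p (insert x V) f = p * expect p V (\<lambda>R. f (insert x R)) + (1 - p) * expect p V f"
proof -
  have inj: "inj_on (insert x) (Pow V)"
    using assms(2) by (auto simp: inj_on_def)
  have disj: "Pow V \<inter> insert x ` Pow V = {}"
    using assms(2) by auto
  have "expect p (insert x V) f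
      = (\<Sum>R\<in>Pow V. p ^ card R * (1 - p) ^ card (insert x V - R) * f R)
      + (\<Sum>R\<in>Pow V. p ^ card (insert x R) * (1 - p) ^ card (insert x V - insert x R) * f (insert x R))"
    unfolding expect_def Pow_insert
    using assms disj by (subst sum.union_disjoint) (auto simp: sum.reindex[OF inj])
  moreover have "(\<Sum>R\<in>Pow V. p ^ card R * (1 - p) ^ card (insert x V - R) * f R)
      = (1 - p) * expect p V f"
    unfolding expect_def sum_distrib_left
  proof (rule sum.cong)
    fix R assume "R \<in> Pow V"
    then have "insert x V - R = insert x (V - R)" "x \<notin> V - R" using assms by auto
    then show "p ^ card R * (1 - p) ^ card (insert x V - R) * f R
        = (1 - p) * (p ^ card R * (1 - p) ^ card (V - R) * f R)"
      using assms(1) by simp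
  qed simp
  moreover have "(\<Sum>R\<in>Pow V. p ^ card (insert x R) * (1 - p) ^ card (insert x V - insert x R) * f (insert x R))
      = p * expect p V (\<lambda>R. f (insert x R))"
    unfolding expect_def sum_distrib_left
  proof (rule sum.cong)
    fix R assume "R \<in> Pow V"
    then have "insert x V - insert x R = V - R" "x \<notin> R" "finite R"
      using assms finite_subset by auto
    then show "p ^ card (insert x R) * (1 - p) ^ card (insert x V - insert x R) * f (insert x R)
        = p * (p ^ card R * (1 - p) ^ card (V - R) * f (insert x R))"
      by simp
  qed simp
  ultimately show ?thesis by simp
qed

lemma expect_remove:
  assumes "finite V" "x \<in> V"
  shows "expect p V f
    = p * expect p (V - {x}) (\<lambda>R. f (insert x R)) + (1 - p) * expect p (V - {x}) f"
  using expect_insert[of "V - {x}" x p f] assms by (simp add: insert_absorb)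

lemma expect_cong:
  "(\<And>R. R \<subseteq> V \<Longrightarrow> f R = g R) \<Longrightarrow> expect p V f = expect p V g"
  unfolding expect_def by (intro sum.cong) auto

lemma expect_mono:
  assumes "0 \<le> p" "p \<le> 1" "\<And>R. R \<subseteq> V \<Longrightarrow> f R \<le> g R"
  shows "expect p V f \<le> expect p V g"
  unfolding expect_def using assms by (intro sum_mono mult_left_mono) auto

lemma expect_const: "finite V \<Longrightarrow> expect p V (\<lambda>_. c) = c"
  by (induction V rule: finite_induct) (simp_all add: expect_insert algebra_simps)

lemma expect_nonneg:
  assumes "finite V" "0 \<le> p" "p \<le> 1" "\<And>R. R \<subseteq> V \<Longrightarrow> 0 \<le> f R"
  shows "0 \<le> expect p V f"
  using expect_mono[of p V "\<lambda>_. 0" f] assms by (simp add: expect_const)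

lemma expect_add: "expect p V (\<lambda>R. f R + g R) = expect p V f + expect p V g"
  by (simp add: expect_def algebra_simps sum.distrib)

lemma expect_diff: "expect p V (\<lambda>R. f R - g R) = expect p V f - expect p V g"
  by (simp add: expect_def algebra_simps sum_subtractf)

text \<open>The complement of a \<open>p\<close>-biased random set is
  \<open>(1 - p)\<close>-biased.\<close>

lemma expect_complement:
  assumes "finite V"
  shows "expect (1 - p) V f = expect p V (\<lambda>R. f (V - R))"
  unfolding expect_def
  by (rule sum.reindex_bij_witness[of _ "\<lambda>R. V - R" "\<lambda>R. V - R"]) (auto simp: double_diff)

lemma expect_superset:
  assumes "finite V" "A \<subseteq> V"
  shows "expect p V (\<lambda>R. of_bool (A \<subseteq> R)) = p ^ card A"
  using assms
proof (induction V arbitrary: A rule: finite_induct)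
  case empty
  then show ?case by simp
next
  case (insert x V)
  show ?case
  proof (cases "x \<in> A")
    case True
    have "expect p V (\<lambda>R. of_bool (A \<subseteq> insert x R)) = p ^ card (A - {x})"
      using insert.IH[of "A - {x}"] insert.prems by (simp add: subset_insert_iff True)
    moreover have "expect p V (\<lambda>R. of_bool (A \<subseteq> R)) = expect p V (\<lambda>_. 0)"
      using True insert.hyps by (intro expect_cong) auto
    moreover have "card A = Suc (card (A - {x}))"
      using True insert.prems insert.hyps finite_subset
      by (metis card_Suc_Diff1 finite.insertI)
    ultimately show ?thesis
      using insert.hyps by (simp add: expect_insert expect_const)
  next
    case False
    then have "A \<subseteq> V" "\<And>R. A \<subseteq> insert x R \<longleftrightarrow> A \<subseteq> R" using insert.prems by auto
    then show ?thesis
      using insert.hyps insert.IH[of A] by (simp add: expect_insert algebra_simps)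
  qed
qed

section \<open>Correlation inequalities for monotone families\<close>

text \<open>When a point \<open>x\<close> is added, the two conditional averages of \<open>f\<close>
  and of \<open>g\<close> are ordered the same way. The mean of the products exceeds the product of
  the means by \<open>p * (1 - p)\<close> times the product of the two differences.\<close>

lemma harris:
  assumes "finite V" "0 \<le> p" "p \<le> 1"
    and "\<And>A B. A \<subseteq> B \<Longrightarrow> B \<subseteq> V \<Longrightarrow> f B \<le> f A"
    and "\<And>A B. A \<subseteq> B \<Longrightarrow> B \<subseteq> V \<Longrightarrow> g B \<le> g A"
  shows "expect p V f * expect p V g \<le> expect p V (\<lambda>R. f R * g R)"
  using assms(1,4,5)
proof (induction V arbitrary: f g rule: finite_induct)
  case empty
  then show ?case by simp
next
  case (insert x V)
  let ?f = "\<lambda>R. f (insert x R)" and ?g = "\<lambda>R. g (insert x R)"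
  let ?a = "expect p V ?f" and ?b = "expect p V ?g"
  have 1: "?a * ?b \<le> expect p V (\<lambda>R. ?f R * ?g R)"
    by (rule insert.IH) (auto intro!: insert.prems)
  have 2: "expect p V f * expect p V g \<le> expect p V (\<lambda>R. f R * g R)"
    by (rule insert.IH) (auto intro!: insert.prems)
  have "?a \<le> expect p V f" "?b \<le> expect p V g"
    using assms(2,3) by (auto intro!: expect_mono insert.prems)
  then have "0 \<le> p * (1 - p) * ((expect p V f - ?a) * (expect p V g - ?b))"
    using assms(2,3) by simp
  then have "expect p (insert x V) f * expect p (insert x V) g
      \<le> p * (?a * ?b) + (1 - p) * (expect p V f * expect p V g)"
    using insert.hyps by (simp add: expect_insert algebra_simps)
  also have "\<dots> \<le> expect p (insert x V) (\<lambda>R. f R * g R)"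
    using 1 2 assms(2,3) insert.hyps
    by (simp add: expect_insert add_mono mult_left_mono)
  finally show ?case .
qed

text \<open>Harris' inequality iterated; nonnegativity keeps the partial products
  antimonotone.\<close>

lemma expect_prod_antimono:
  assumes "finite V" "0 \<le> p" "p \<le> 1" "finite I"
    and anti: "\<And>i A B. i \<in> I \<Longrightarrow> A \<subseteq> B \<Longrightarrow> B \<subseteq> V \<Longrightarrow> f i B \<le> f i A"
    and nonneg: "\<And>i A. i \<in> I \<Longrightarrow> A \<subseteq> V \<Longrightarrow> 0 \<le> f i A"
  shows "(\<Prod>i\<in>I. expect p V (f i)) \<le> expect p V (\<lambda>R. \<Prod>i\<in>I. f i R)"
  using assms(4) anti nonneg
proof (induction I rule: finite_induct)
  case empty
  then show ?case using assms(1) by (simp add: expect_const)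
next
  case (insert i I)
  have "(\<Prod>i\<in>I. expect p V (f i)) \<le> expect p V (\<lambda>R. \<Prod>i\<in>I. f i R)"
    using insert by auto
  moreover have "0 \<le> expect p V (f i)"
    using insert.prems assms by (auto intro!: expect_nonneg)
  moreover have "expect p V (f i) * expect p V (\<lambda>R. \<Prod>i\<in>I. f i R)
      \<le> expect p V (\<lambda>R. f i R * (\<Prod>i\<in>I. f i R))"
    using assms(1-3) insert.prems by (intro harris) (auto intro!: prod_mono)
  ultimately show ?case
    using insert.hyps by (simp, meson mult_left_mono order_trans)
qed

text \<open>The intersection of two independent \<open>r\<close>-biased random sets is \<open>r\<^sup>2\<close>-biased,
  and it lies in an up-set only if both sets do.\<close>
lemma expect_square:
  assumes "finite V" "0 \<le> r" "r \<le> 1"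
    and "\<And>A B. A \<subseteq> B \<Longrightarrow> B \<subseteq> V \<Longrightarrow> P A \<Longrightarrow> P B"
  shows "expect (r\<^sup>2) V (\<lambda>R. of_bool (P R)) \<le> (expect r V (\<lambda>R. of_bool (P R)))\<^sup>2"
  using assms(1,4)
proof (induction V arbitrary: P rule: finite_induct)
  case empty
  then show ?case by simp
next
  case (insert x V)
  let ?a = "expect r V (\<lambda>R. of_bool (P (insert x R)))" and ?b = "expect r V (\<lambda>R. of_bool (P R))"
  have 1: "expect (r\<^sup>2) V (\<lambda>R. of_bool (P (insert x R))) \<le> ?a\<^sup>2"
    by (rule insert.IH) (use insert.prems in \<open>meson insert_mono\<close>)
  have 2: "expect (r\<^sup>2) V (\<lambda>R. of_bool (P R)) \<le> ?b\<^sup>2"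
    by (rule insert.IH) (use insert.prems in blast)
  have "?b \<le> ?a"
    using assms(2,3) insert.prems by (intro expect_mono) (auto, blast)
  moreover have "0 \<le> ?b" using assms insert.hyps by (auto intro!: expect_nonneg)
  \<comment> \<open>This quantity is exactly \<open>(r * ?a + (1 - r) * ?b)\<^sup>2 - (r\<^sup>2 *
    ?a\<^sup>2 + (1 - r\<^sup>2) * ?b\<^sup>2)\<close>.\<close>
  ultimately have nn: "0 \<le> 2 * r * (1 - r) * (?b * (?a - ?b))" using assms(2,3) by simp
  have r2: "r\<^sup>2 \<le> 1" using assms(2,3) by (simp add: power_le_one)
  have "expect (r\<^sup>2) (insert x V) (\<lambda>R. of_bool (P R)) \<le> r\<^sup>2 * ?a\<^sup>2 + (1 - r\<^sup>2) * ?b\<^sup>2"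
    using 1 2 r2 insert.hyps by (simp add: expect_insert add_mono mult_left_mono)
  also have "\<dots> \<le> (r * ?a + (1 - r) * ?b)\<^sup>2"
    using nn by (simp add: power2_eq_square algebra_simps)
  finally show ?case using insert.hyps by (simp add: expect_insert)
qed

text \<open>Condition on the first element \<open>x\<close> of \<open>A\<close> that lies in
  \<open>R\<close>. Some element is hit with probability \<open>1 - (1 - p) ^ card A\<close>, and
  the absence of the earlier elements only lowers the measure of the link at
  \<open>x\<close>.\<close>

lemma expect_hitting:
  assumes "finite A" "finite V" "A \<subseteq> V" "0 \<le> p" "p \<le> 1"
    and "\<And>R S. R \<subseteq> S \<Longrightarrow> S \<subseteq> V \<Longrightarrow> P R \<Longrightarrow> P S"
    and "\<And>x. x \<in> A \<Longrightarrow> expect p (V - {x}) (\<lambda>R. of_bool (P (insert x R))) \<le> c"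
  shows "expect p V (\<lambda>R. of_bool (P R \<and> R \<inter> A \<noteq> {})) \<le> (1 - (1 - p) ^ card A) * c"
  using assms(1,2,3,6,7)
proof (induction A arbitrary: V rule: finite_induct)
  case empty
  then show ?case by (simp add: expect_const)
next
  case (insert a A)
  let ?W = "V - {a}"
  have aV: "a \<in> V" and fW: "finite ?W" using insert.prems by auto
  have "expect p ?W (\<lambda>R. of_bool (P R \<and> R \<inter> A \<noteq> {})) \<le> (1 - (1 - p) ^ card A) * c"
  proof (rule insert.IH[OF fW])
    show "A \<subseteq> ?W" using insert.hyps insert.prems by auto
    show "P S" if "R \<subseteq> S" "S \<subseteq> ?W" "P R" for R S
      using insert.prems(3)[of R S] that by blast
    fix x assume x: "x \<in> A"
    then have ax: "a \<in> V - {x}" and xV: "x \<in> V" using aV insert.hyps insert.prems by auto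
    \<comment> \<open>Forbidding \<open>a\<close> cannot raise the measure of an up-set, so the
      bound \<open>c\<close> on the links survives the passage to \<open>?W\<close>.\<close>
    have le: "expect p (V - {x} - {a}) (\<lambda>R. of_bool (P (insert x R)))
        \<le> expect p (V - {x} - {a}) (\<lambda>R. of_bool (P (insert x (insert a R))))"
    proof (rule expect_mono[OF assms(4,5)])
      fix R assume "R \<subseteq> V - {x} - {a}"
      then show "of_bool (P (insert x R)) \<le> (of_bool (P (insert x (insert a R))) :: real)"
        using insert.prems(3)[of "insert x R" "insert x (insert a R)"] xV aV by auto
    qed
    have "expect p (V - {x} - {a}) (\<lambda>R. of_bool (P (insert x R)))
        \<le> expect p (V - {x}) (\<lambda>R. of_bool (P (insert x R)))"
      using mult_left_mono[OF le assms(4)] ax insert.prems(1)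
      by (subst expect_remove[of "V - {x}" a]) (auto simp: algebra_simps)
    also have "\<dots> \<le> c" using insert.prems(4) x by auto
    finally show "expect p (?W - {x}) (\<lambda>R. of_bool (P (insert x R))) \<le> c"
      by (simp add: Diff_insert2[symmetric] insert_commute)
  qed
  moreover have "expect p ?W (\<lambda>R. of_bool (P (insert a R))) \<le> c"
    using insert.prems(4) by auto
  moreover have "expect p ?W (\<lambda>R. of_bool (P R \<and> R \<inter> insert a A \<noteq> {}))
      = expect p ?W (\<lambda>R. of_bool (P R \<and> R \<inter> A \<noteq> {}))"
    by (intro expect_cong) auto
  ultimately have "expect p V (\<lambda>R. of_bool (P R \<and> R \<inter> insert a A \<noteq> {}))
      \<le> p * c + (1 - p) * ((1 - (1 - p) ^ card A) * c)"
    using assms(4,5) insert.prems(1) aV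
    by (subst expect_remove[of V a]) (simp_all add: add_mono mult_left_mono)
  then show ?case using insert.hyps by (simp add: algebra_simps)
qed

section \<open>Non-trivial intersecting families\<close>

text \<open>The bias used below is \<open>p = golden\<^sup>2 = 1 - golden\<close>: then \<open>expect_square\<close> bounds
  the \<open>p\<close>-biased measure of an up-set by the square of its \<open>(1 - p)\<close>-biased measure.\<close>
definition golden :: real where
  "golden = (sqrt 5 - 1) / 2"

lemma golden_square: "golden\<^sup>2 = 1 - golden"
  by (simp add: golden_def power2_eq_square field_simps)

lemma golden_pos: "0 < golden" and golden_le: "golden \<le> 5 / 8"
proof -
  have "1 < sqrt 5" by simp
  then show "0 < golden" by (simp add: golden_def)
  have "sqrt 5 \<le> 9 / 4" by (rule real_le_lsqrt) (simp_all add: power2_eq_square)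
  then have "(sqrt 5 - 1) / 2 \<le> (9 / 4 - 1) / (2 :: real)"
    by (intro divide_right_mono diff_right_mono) auto
  then show "golden \<le> 5 / 8" by (simp add: golden_def)
qed

definition generated :: "'a set set \<Rightarrow> 'a set \<Rightarrow> bool" where
  "generated F R \<longleftrightarrow> (\<exists>A\<in>F. A \<subseteq> R)"

lemma generated_mono: "R \<subseteq> S \<Longrightarrow> generated F R \<Longrightarrow> generated F S"
  unfolding generated_def by blast

text \<open>Let \<open>u x\<close> be the \<open>(1 - p)\<close>-biased measure of the generated sets avoiding \<open>x\<close>. Cross-intersection
  of the two links at \<open>x\<close> settles the case that some \<open>u x\<close> is not close to \<open>1 - p\<close>. Otherwise every link has
  measure hardly above \<open>p\<close>, and one conditions on the first element at which a fixed member is hit.\<close>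
lemma expect_nontrivial_intersecting:
  assumes fin: "finite V" and F: "F \<subseteq> nsets V k" and int: "intersecting F"
    and nontriv: "\<And>x. x \<in> V \<Longrightarrow> \<exists>A\<in>F. x \<notin> A" and "F \<noteq> {}"
  shows "expect (golden\<^sup>2) V (\<lambda>R. of_bool (generated F R)) \<le> golden\<^sup>2 * (1 - golden ^ (k + 4))"
proof -
  define t where "t = golden"
  \<comment> \<open>\<open>t ^ k\<close> is the least possible value of \<open>u x\<close>; the
    extra \<open>t ^ 4\<close> is the slack used in both cases below.\<close>
  define e where "e = t ^ (k + 4)"
  let ?p = "t\<^sup>2"
  let ?G = "\<lambda>R. of_bool (generated F R) :: real"
  have t: "0 < t" "t \<le> 5 / 8" "t\<^sup>2 = 1 - t"
    using golden_pos golden_le golden_square by (auto simp: t_def)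
  have t2: "t * t = 1 - t" using t(3) by (simp add: power2_eq_square)
  have p: "0 \<le> ?p" "?p \<le> 1" "1 - ?p = t" using t by auto
  have "t ^ 4 \<le> (5 / 8) ^ 4" using t by (intro power_mono) auto
  then have t4: "t ^ 4 \<le> 1 / 2" by (rule order_trans) (simp add: eval_nat_numeral)
  have e: "0 < e" "e = t ^ k * t ^ 4" using t by (auto simp: e_def power_add)
  have tk: "0 < t ^ k" using t by simp
  define u where "u x = expect t (V - {x}) ?G" for x
  have bound1: "expect ?p V ?G \<le> ?p * (1 - u x) + t * (u x)\<^sup>2"
    and bound2: "expect ?p (V - {x}) (\<lambda>R. ?G (insert x R)) \<le> 1 - u x"
    and u_ge: "t ^ k \<le> u x" if x: "x \<in> V" for x
  proof -
    let ?W = "V - {x}"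
    have fW: "finite ?W" using fin by simp
    have "expect ?p ?W (\<lambda>R. ?G (insert x R)) + expect ?p ?W (\<lambda>R. ?G (?W - R))
        = expect ?p ?W (\<lambda>R. ?G (insert x R) + ?G (?W - R))"
      by (simp add: expect_add)
    also have "\<dots> \<le> expect ?p ?W (\<lambda>_. 1)"
    proof (rule expect_mono[OF p(1,2)])
      fix R assume R: "R \<subseteq> ?W"
      \<comment> \<open>Members inside \<open>insert x R\<close> and \<open>?W - R\<close> would be
        disjoint.\<close>
      have "\<not> (generated F (insert x R) \<and> generated F (?W - R))"
        using int unfolding generated_def intersecting_def by blast
      then show "?G (insert x R) + ?G (?W - R) \<le> 1" by auto
    qed
    also have "expect ?p ?W (\<lambda>R. ?G (?W - R)) = u x"
      using expect_complement[OF fW, of ?p ?G] p(3) by (simp add: u_def)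
    finally show b2: "expect ?p ?W (\<lambda>R. ?G (insert x R)) \<le> 1 - u x"
      using fW by (simp add: expect_const)
    \<comment> \<open>The choice \<open>?p = t\<^sup>2\<close> with \<open>1 - ?p = t\<close> makes
      the same \<open>u x\<close> appear in both halves of the split at \<open>x\<close>.\<close>
    have "expect ?p ?W ?G \<le> (u x)\<^sup>2"
      unfolding u_def using t fW generated_mono by (intro expect_square) auto
    then show "expect ?p V ?G \<le> ?p * (1 - u x) + t * (u x)\<^sup>2"
      using b2 p t fin x by (subst expect_remove[of V x]) (auto intro!: add_mono mult_left_mono)
    obtain A where A: "A \<in> F" "x \<notin> A" using nontriv x by blast
    then have "A \<subseteq> ?W" "card A = k" using F by (auto simp: nsets_def)
    then have "t ^ k = expect t ?W (\<lambda>R. of_bool (A \<subseteq> R))"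
      using fW by (simp add: expect_superset)
    also have "\<dots> \<le> u x"
      unfolding u_def using t A by (intro expect_mono) (auto simp: generated_def)
    finally show "t ^ k \<le> u x" .
  qed
  show ?thesis
  proof (cases "\<exists>x\<in>V. u x \<le> t - 2 * e")
    case True
    then obtain x where x: "x \<in> V" "u x \<le> t - 2 * e" by blast
    have u0: "0 \<le> u x" using tk u_ge[OF x(1)] by linarith
    \<comment> \<open>The bound from the split equals \<open>?p - t * u x * (t - u x)\<close>, so
      this is the required gain. The concave function \<open>u * (t - u)\<close> is estimated on
      either side of \<open>t / 2\<close>.\<close>
    have "t * e \<le> u x * (t - u x)"
    proof (cases "u x \<le> t / 2")
      case True
      have "(t ^ k * t) * t ^ 4 \<le> (t ^ k * t) * (1 / 2)" using t4 t tk by (intro mult_left_mono) auto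
      then have "t * e \<le> t ^ k * (t / 2)" by (simp add: e mult_ac)
      also have "\<dots> \<le> u x * (t - u x)"
        using True u_ge[OF x(1)] u0 t by (intro mult_mono) auto
      finally show ?thesis .
    next
      case False
      have "t * e = t / 2 * (2 * e)" by simp
      also have "\<dots> \<le> u x * (t - u x)"
        using False x(2) e t by (intro mult_mono) auto
      finally show ?thesis .
    qed
    then have "t * (t * e) \<le> t * (u x * (t - u x))" using t by simp
    then have "?p * (1 - u x) + t * (u x)\<^sup>2 \<le> ?p * (1 - e)"
      by (simp add: power2_eq_square algebra_simps)
    then show ?thesis using bound1[OF x(1)] by (simp add: t_def e_def)
  next
    case False
    obtain A where A: "A \<in> F" using \<open>F \<noteq> {}\<close> by blast
    then have AV: "A \<subseteq> V" "card A = k" "finite A" using F by (auto simp: nsets_def)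
    have "expect ?p V ?G = expect ?p V (\<lambda>R. of_bool (generated F R \<and> R \<inter> A \<noteq> {}))"
      using int A unfolding generated_def intersecting_def
      by (intro expect_cong) (auto, blast)
    also have "\<dots> \<le> (1 - (1 - ?p) ^ card A) * (?p + 2 * e)"
    proof (rule expect_hitting[OF AV(3) fin AV(1) p(1,2)])
      show "generated F S" if "R \<subseteq> S" "generated F R" for R S
        using that generated_mono by blast
      fix x assume "x \<in> A"
      then have "x \<in> V" using AV by auto
      then show "expect ?p (V - {x}) (\<lambda>R. ?G (insert x R)) \<le> ?p + 2 * e"
        using bound2[of x] False t by fastforce
    qed
    also have "\<dots> = (1 - t ^ k) * (?p + 2 * e)" using p(3) AV by simp
    \<comment> \<open>The factor \<open>1 - t ^ k\<close> gains \<open>t ^ k * ?p\<close>, which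
      outweighs the loss \<open>2 * e\<close> and the target gain \<open>?p * e\<close>.\<close>
    also have "\<dots> \<le> ?p * (1 - e)"
    proof -
      have "t\<^sup>2 \<le> (5 / 8)\<^sup>2" using t by (intro power_mono) auto
      then have "t\<^sup>2 * (2 + t\<^sup>2) \<le> (5 / 8)\<^sup>2 * (2 + (5 / 8)\<^sup>2)" by (intro mult_mono) auto
      then have "t\<^sup>2 * (t\<^sup>2 * (2 + t\<^sup>2)) \<le> t\<^sup>2 * 1"
        by (intro mult_left_mono) (auto simp: power2_eq_square)
      then have "t ^ 4 * (2 + t\<^sup>2) \<le> t\<^sup>2" by (simp add: power2_eq_square power4_eq_xxxx mult.assoc)
      then have "t ^ k * (t ^ 4 * (2 + t\<^sup>2)) \<le> t ^ k * t\<^sup>2" using tk by simp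
      then have "e * (2 + ?p) \<le> t ^ k * ?p" by (simp add: e)
      moreover have "0 \<le> t ^ k * e" using tk e by simp
      ultimately show ?thesis by (simp add: algebra_simps)
    qed
    finally show ?thesis by (simp add: t_def e_def)
  qed
qed

section \<open>Shadows\<close>

text \<open>Keevash's form of the Kruskal--Katona theorem: the conclusion is linear in \<open>card G\<close>,
  so that the induction on \<open>r\<close> can be applied to the links, and no compression is needed.\<close>
lemma kruskal_katona_step:
  assumes "finite V" "G \<subseteq> nsets V r" "K \<subseteq> nsets V (Suc r)"
    and "\<And>B b. B \<in> K \<Longrightarrow> b \<in> B \<Longrightarrow> B - {b} \<in> G"
    and "card G \<le> m choose r" "r = 0 \<Longrightarrow> G = {}"
  shows "Suc r * card K + r * card G \<le> m * card G"
  using assms(2-)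
proof (induction r arbitrary: G K m)
  \<comment> \<open>Emptiness of \<open>G\<close> matters here: \<open>G = {{}}\<close> would admit
    any number of singletons in \<open>K\<close>.\<close>
  case 0
  have "K = {}"
  proof (rule ccontr)
    assume "K \<noteq> {}"
    then obtain B where B: "B \<in> K" by blast
    then have "card B = 1" using "0.prems" by (auto simp: nsets_def)
    then obtain b where "b \<in> B" by (metis card_1_singletonE singletonI)
    then show False using "0.prems" B by blast
  qed
  then show ?case by simp
next
  case (Suc r)
  have finG: "finite G" and finK: "finite K"
    using Suc.prems(1,2) finite_imp_finite_nsets[OF assms(1)] finite_subset by blast+
  define Gv where "Gv v = {A - {v} | A. A \<in> G \<and> v \<in> A}" for v
  define Kv where "Kv v = {B - {v} | B. B \<in> K \<and> v \<in> B}" for v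
  have cardG: "card (Gv v) = card {A \<in> G. v \<in> A}" for v
  proof -
    have "Gv v = (\<lambda>A. A - {v}) ` {A \<in> G. v \<in> A}" by (auto simp: Gv_def)
    moreover have "inj_on (\<lambda>A. A - {v}) {A \<in> G. v \<in> A}" by (auto simp: inj_on_def)
    ultimately show ?thesis by (simp add: card_image)
  qed
  have cardK: "card (Kv v) = card {A \<in> K. v \<in> A}" for v
  proof -
    have "Kv v = (\<lambda>A. A - {v}) ` {A \<in> K. v \<in> A}" by (auto simp: Kv_def)
    moreover have "inj_on (\<lambda>A. A - {v}) {A \<in> K. v \<in> A}" by (auto simp: inj_on_def)
    ultimately show ?thesis by (simp add: card_image)
  qed
  have double: "(\<Sum>v\<in>V. card {A \<in> X. v \<in> A}) = j * card X" if "X \<subseteq> nsets V j" "finite X" for X j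
  proof -
    have "(\<Sum>v\<in>V. card {A \<in> X. v \<in> A}) = (\<Sum>v\<in>V. \<Sum>A\<in>X. of_bool (v \<in> A))"
      using that(2) by (simp add: sum.If_cases of_bool_def Int_def)
    also have "\<dots> = (\<Sum>A\<in>X. \<Sum>v\<in>V. of_bool (v \<in> A))" by (rule sum.swap)
    also have "\<dots> = (\<Sum>A\<in>X. j)"
    proof (rule sum.cong)
      fix A assume "A \<in> X"
      then have "A \<subseteq> V" "card A = j" using that by (auto simp: nsets_def)
      moreover from this have "{v \<in> V. v \<in> A} = A" by auto
      ultimately show "(\<Sum>v\<in>V. of_bool (v \<in> A)) = j"
        using assms(1) by (simp add: sum.If_cases of_bool_def Int_def)
    qed simp
    finally show ?thesis by simp
  qed
  \<comment> \<open>The inequality for the links at \<open>v\<close>. Summing over \<open>v\<close>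
    counts each member of \<open>G\<close> and of \<open>K\<close> once per element, and the common
    factor \<open>Suc r\<close> cancels.\<close>
  have local: "Suc r * card (Kv v) + Suc r * card (Gv v) \<le> m * card (Gv v)" for v
  proof (cases m)
    case 0
    then have "G = {}" using Suc.prems(4) finG by simp
    then have "K = {}"
      using Suc.prems(2,3) by (fastforce simp: nsets_def card_eq_0_iff)
    then show ?thesis using \<open>G = {}\<close> by (simp add: Gv_def Kv_def)
  next
    case (Suc m')
    show ?thesis
    \<comment> \<open>A large link is settled by
      \<open>card (Kv v) + card (Gv v) \<le> card G\<close> and the size hypothesis on
      \<open>G\<close>. A smaller link meets the size hypothesis for \<open>m'\<close>, and
      strictness makes it empty when \<open>r = 0\<close>.\<close>
    proof (cases "m' choose r \<le> card (Gv v)")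
      case True
      have "Kv v \<subseteq> {A \<in> G. v \<notin> A}" using Suc.prems(3) by (auto simp: Kv_def)
      then have "card (Kv v) \<le> card {A \<in> G. v \<notin> A}" using finG by (intro card_mono) auto
      also have "\<dots> + card (Gv v) = card G"
      proof -
        have "G = {A \<in> G. v \<notin> A} \<union> {A \<in> G. v \<in> A}" by auto
        then show ?thesis unfolding cardG using finG
          by (subst (3) \<open>G = _\<close>, subst card_Un_disjoint) auto
      qed
      finally have "card (Kv v) + card (Gv v) \<le> m choose Suc r" using Suc.prems(4) by simp
      then have "Suc r * (card (Kv v) + card (Gv v)) \<le> Suc r * (m choose Suc r)"
        by (rule mult_le_mono2)
      also have "\<dots> = m * (m' choose r)" using Suc by (metis Suc_times_binomial_eq mult.commute)
      also have "\<dots> \<le> m * card (Gv v)" using True by simp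
      finally show ?thesis by (simp add: algebra_simps)
    next
      case False
      have "Suc r * card (Kv v) + r * card (Gv v) \<le> m' * card (Gv v)"
      proof (rule Suc.IH)
        show "Gv v \<subseteq> nsets V r" using Suc.prems(1) by (fastforce simp: Gv_def nsets_def)
        show "Kv v \<subseteq> nsets V (Suc r)" using Suc.prems(2) by (fastforce simp: Kv_def nsets_def)
        show "B - {b} \<in> Gv v" if B: "B \<in> Kv v" "b \<in> B" for B b
        proof -
          obtain C where C: "C \<in> K" "v \<in> C" "B = C - {v}" using B(1) by (auto simp: Kv_def)
          then have "C - {b} \<in> G" "v \<in> C - {b}" using B Suc.prems(3) by auto
          moreover have "B - {b} = C - {b} - {v}" using C by auto
          ultimately show ?thesis unfolding Gv_def by blast
        qed
        show "card (Gv v) \<le> m' choose r" using False by simp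
        assume "r = 0"
        then have "card (Gv v) = 0" using False by simp
        moreover have "finite (Gv v)" using finG by (simp add: Gv_def)
        ultimately show "Gv v = {}" by simp
      qed
      then show ?thesis using Suc by (simp add: algebra_simps)
    qed
  qed
  have "(\<Sum>v\<in>V. Suc r * card (Kv v) + Suc r * card (Gv v)) \<le> (\<Sum>v\<in>V. m * card (Gv v))"
    by (rule sum_mono) (rule local)
  then have "Suc r * (Suc (Suc r) * card K) + Suc r * (Suc r * card G) \<le> m * (Suc r * card G)"
    unfolding sum.distrib sum_distrib_left[symmetric] cardG cardK
      double[OF Suc.prems(1) finG] double[OF Suc.prems(2) finK] .
  then have "Suc r * (Suc (Suc r) * card K + Suc r * card G) \<le> Suc r * (m * card G)"
    by (simp add: algebra_simps)
  then show ?case by (simp only: Suc_mult_le_cancel1)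
qed

section \<open>Counting uncovered sets\<close>

text \<open>The quadratic bound on \<open>m\<close> enters here. The base on the left is so close to
  \<open>golden\<close> that its fourth power is at most \<open>golden ^ 3\<close>; comparing
  exponents leaves \<open>4 * (k + 4) * (k - 1) < 3 * m\<close>.\<close>

lemma golden_power_less:
  assumes "2 \<le> k" "2 * k\<^sup>2 + 1 \<le> m"
  shows "(golden + golden\<^sup>2 * golden ^ (k + 4)) ^ m < (golden ^ (k + 4)) ^ (k - 1)"
proof -
  define t where "t = golden"
  define y where "y = t + t\<^sup>2 * t ^ (k + 4)"
  have t: "0 < t" "t \<le> 5 / 8" using golden_pos golden_le by (auto simp: t_def)
  then have y0: "0 \<le> y" by (simp add: y_def)
  have y: "y = t * (1 + t ^ (k + 5))"
    by (simp add: y_def power2_eq_square power_add algebra_simps eval_nat_numeral)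
  have "t ^ (k + 5) \<le> t ^ 7" using t assms(1) by (intro power_decreasing) auto
  also have "\<dots> \<le> (5 / 8) ^ 7" using t by (intro power_mono) auto
  finally have "(1 + t ^ (k + 5)) ^ 4 \<le> (1 + (5 / 8) ^ 7) ^ 4"
    using t by (intro power_mono) auto
  then have "t * (1 + t ^ (k + 5)) ^ 4 \<le> 5 / 8 * (1 + (5 / 8) ^ 7) ^ 4"
    using t by (intro mult_mono) auto
  also have "\<dots> \<le> 1" by (simp add: eval_nat_numeral)
  finally have "t ^ 3 * (t * (1 + t ^ (k + 5)) ^ 4) \<le> t ^ 3 * 1"
    using t by (intro mult_left_mono) auto
  moreover have "y ^ 4 = t ^ 3 * (t * (1 + t ^ (k + 5)) ^ 4)"
    unfolding y power_mult_distrib by (simp add: eval_nat_numeral)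
  ultimately have "y ^ 4 \<le> t ^ 3" by simp
  then have "(y ^ m) ^ 4 \<le> t ^ (3 * m)"
    using y0 power_mono[of "y ^ 4" "t ^ 3" m] by (simp add: power_mult[symmetric] mult.commute)
  also have "\<dots> < t ^ ((k + 4) * (k - 1) * 4)"
  proof (rule power_strict_decreasing)
    obtain j where j: "k = j + 2" using assms(1) by (metis le_add_diff_inverse2)
    have "2 * j \<le> j\<^sup>2 + 1"
      by (cases j) (auto simp: power2_eq_square)
    then show "(k + 4) * (k - 1) * 4 < 3 * m"
      using assms(2) unfolding j by (simp add: power2_eq_square algebra_simps)
  qed (use t in auto)
  also have "\<dots> = ((t ^ (k + 4)) ^ (k - 1)) ^ 4" by (simp add: power_mult)
  finally have "y ^ m < (t ^ (k + 4)) ^ (k - 1)" by (rule power_less_imp_less_base) (use t in simp)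
  then show ?thesis by (simp add: y_def t_def)
qed

lemma expect_by_card:
  fixes p :: real
  assumes "finite V"
  shows "expect p V (\<lambda>R. of_bool (P R))
    = (\<Sum>j\<le>card V. card {B \<in> nsets V j. P B} * (p ^ j * (1 - p) ^ (card V - j)))"
proof -
  have "expect p V (\<lambda>R. of_bool (P R))
      = (\<Sum>j\<le>card V. \<Sum>R | R \<in> Pow V \<and> card R = j. p ^ card R * (1 - p) ^ card (V - R) * of_bool (P R))"
    unfolding expect_def using assms
    by (intro sum.group[symmetric]) (auto simp: card_mono)
  also have "\<dots> = (\<Sum>j\<le>card V. card {B \<in> nsets V j. P B} * (p ^ j * (1 - p) ^ (card V - j)))"
  proof (rule sum.cong[OF refl])
    fix j
    have eq: "{R \<in> Pow V. card R = j} = nsets V j"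
      using assms finite_subset by (auto simp: nsets_def)
    have "(\<Sum>R | R \<in> Pow V \<and> card R = j. p ^ card R * (1 - p) ^ card (V - R) * of_bool (P R))
        = (\<Sum>R\<in>nsets V j. of_bool (P R) * (p ^ j * (1 - p) ^ (card V - j)))"
      unfolding eq using assms by (intro sum.cong) (auto simp: nsets_def card_Diff_subset)
    also have "\<dots> = card {B \<in> nsets V j. P B} * (p ^ j * (1 - p) ^ (card V - j))"
      using finite_imp_finite_nsets[OF assms, of j]
      by (simp add: sum_distrib_right[symmetric] sum.If_cases of_bool_def Int_def)
    finally show "(\<Sum>R | R \<in> Pow V \<and> card R = j. p ^ card R * (1 - p) ^ card (V - R) * of_bool (P R))
        = card {B \<in> nsets V j. P B} * (p ^ j * (1 - p) ^ (card V - j))" .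
  qed
  finally show ?thesis .
qed

text \<open>Generating function of the sets avoiding \<open>s\<close> given points among
  \<open>m + s\<close>. For \<open>a + b = 1\<close> it is their measure \<open>b ^ s\<close>; the
  general form serves the weighted sums.\<close>

lemma binomial_sum_shift:
  fixes a b :: real
  shows "(\<Sum>j\<le>m + s. (m choose j) * (a ^ j * b ^ (m + s - j))) = b ^ s * (a + b) ^ m"
proof -
  have "(\<Sum>j\<le>m + s. (m choose j) * (a ^ j * b ^ (m + s - j)))
      = (\<Sum>j\<le>m. (m choose j) * (a ^ j * b ^ (m + s - j)))"
    by (rule sum.mono_neutral_right) auto
  also have "\<dots> = (\<Sum>j\<le>m. b ^ s * ((m choose j) * a ^ j * b ^ (m - j)))"
    by (rule sum.cong) (auto simp: power_add[symmetric] algebra_simps)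
  also have "\<dots> = b ^ s * (a + b) ^ m"
    by (simp add: binomial_ring sum_distrib_left)
  finally show ?thesis .
qed

text \<open>Passing from level \<open>j\<close> to \<open>j + 1\<close> multiplies the count by at
  most \<open>(m - j) / (j + 1)\<close>, the exact ratio for \<open>m choose j\<close>.\<close>

lemma card_down_closed_le_binomial:
  assumes "finite V" "\<And>R S. R \<subseteq> S \<Longrightarrow> P S \<Longrightarrow> P R"
    and "card {B \<in> nsets V k. P B} \<le> m choose k" "1 \<le> k" "k \<le> j"
  shows "card {B \<in> nsets V j. P B} \<le> m choose j"
  using \<open>k \<le> j\<close>
proof (induction j rule: dec_induct)
  case base
  then show ?case by (rule assms(3))
next
  case (step j)
  let ?d = "\<lambda>j. card {B \<in> nsets V j. P B}"
  have "Suc j * ?d (Suc j) + j * ?d j \<le> m * ?d j"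
  proof (rule kruskal_katona_step[OF assms(1)])
    fix B b assume "B \<in> {B \<in> nsets V (Suc j). P B}" "b \<in> B"
    then show "B - {b} \<in> {B \<in> nsets V j. P B}"
      using assms(2)[of "B - {b}" B] by (auto simp: nsets_def)
  qed (use step.IH step.hyps assms(4) in auto)
  then have "Suc j * ?d (Suc j) \<le> (m - j) * ?d j" by (simp add: diff_mult_distrib)
  also have "\<dots> \<le> (m - j) * (m choose j)" using step.IH by simp
  also have "\<dots> = Suc j * (m choose Suc j)"
    by (metis binomial_absorb_comp binomial_absorption)
  finally show ?case by (simp only: Suc_mult_le_cancel1)
qed

text \<open>Otherwise the levels below \<open>k\<close> must supply an excess of at least
  \<open>y ^ s - t ^ s\<close>, while weighting caps it by this difference times
  \<open>y ^ m / e ^ (k - 1) < 1\<close>.\<close>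

lemma uncovered_nontrivial:
  assumes "finite V" "finite I" "I \<noteq> {}"
    and G: "\<And>i. i \<in> I \<Longrightarrow> G i \<subseteq> nsets V k" "\<And>i. i \<in> I \<Longrightarrow> intersecting (G i)"
    and nontriv: "\<And>i x. i \<in> I \<Longrightarrow> x \<in> V \<Longrightarrow> \<exists>A\<in>G i. x \<notin> A"
    and card: "2 * k\<^sup>2 + 1 + card I \<le> card V"
  shows "(card V - card I) choose k < card {B \<in> nsets V k. \<forall>i\<in>I. B \<notin> G i}"
proof (rule ccontr)
  define s where "s = card I"
  define m where "m = card V - card I"
  define t where "t = golden"
  define e where "e = t ^ (k + 4)"
  \<comment> \<open>Lower bound for the measure of the sets generated by no member of one family; a
    star would give \<open>t\<close>.\<close>
  define y where "y = t + t\<^sup>2 * e"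
  define P where "P R \<longleftrightarrow> (\<forall>i\<in>I. \<not> generated (G i) R)" for R
  define d where "d j = card {B \<in> nsets V j. P B}" for j
  let ?p = "t\<^sup>2"
  assume "\<not> ?thesis"
  then have "card {B \<in> nsets V k. \<forall>i\<in>I. B \<notin> G i} \<le> m choose k" by (simp add: m_def)
  moreover have "{B \<in> nsets V k. P B} \<subseteq> {B \<in> nsets V k. \<forall>i\<in>I. B \<notin> G i}"
    by (auto simp: P_def generated_def)
  moreover have "finite {B \<in> nsets V k. \<forall>i\<in>I. B \<notin> G i}"
    using finite_imp_finite_nsets[OF assms(1), of k] by simp
  ultimately have dk: "card {B \<in> nsets V k. P B} \<le> m choose k"
    by (meson card_mono le_trans)
  have t: "0 < t" "t \<le> 5 / 8" "1 - t\<^sup>2 = t"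
    using golden_pos golden_le golden_square by (auto simp: t_def)
  have e: "0 < e" "e \<le> 1" using t by (simp_all add: e_def power_le_one)
  have n: "card V = m + s" and m: "2 * k\<^sup>2 + 1 \<le> m" using card by (auto simp: m_def s_def)
  have s: "0 < s" using assms(2,3) by (simp add: s_def card_gt_0_iff)
  have ne: "G i \<noteq> {}" if "i \<in> I" for i
  proof -
    have "V \<noteq> {}" using card by auto
    then show ?thesis using nontriv that by blast
  qed
  \<comment> \<open>A member through \<open>x\<close> meets a member missing \<open>x\<close> in a
    second point.\<close>
  have k: "2 \<le> k"
  proof -
    obtain i A where iA: "i \<in> I" "A \<in> G i" using assms(3) ne by blast
    then obtain x where x: "x \<in> A" using G(2) unfolding intersecting_def by blast
    have "A \<in> nsets V k" using iA G(1) by blast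
    then have A: "A \<subseteq> V" "finite A" "card A = k" by (auto simp: nsets_def)
    then obtain B where B: "B \<in> G i" "x \<notin> B" using iA x nontriv by blast
    then obtain z where "z \<in> A" "z \<in> B" using iA G(2) unfolding intersecting_def by blast
    then have "{x, z} \<subseteq> A" "x \<noteq> z" using x B by auto
    then show ?thesis using A card_mono[of A "{x, z}"] by simp
  qed
  have "y ^ s \<le> (\<Prod>i\<in>I. expect ?p V (\<lambda>R. of_bool (\<not> generated (G i) R)))"
  proof -
    have "y \<le> expect ?p V (\<lambda>R. of_bool (\<not> generated (G i) R))" if i: "i \<in> I" for i
    proof -
      have "expect ?p V (\<lambda>R. of_bool (\<not> generated (G i) R))
          = 1 - expect ?p V (\<lambda>R. of_bool (generated (G i) R))"
        using assms(1) by (simp add: of_bool_not_iff expect_diff expect_const)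
      moreover have "expect ?p V (\<lambda>R. of_bool (generated (G i) R)) \<le> ?p * (1 - e)"
        unfolding t_def e_def
        using i G nontriv ne by (intro expect_nontrivial_intersecting[OF assms(1)]) auto
      moreover have "1 - ?p * (1 - e) = y" using t by (simp add: y_def algebra_simps)
      ultimately show ?thesis by linarith
    qed
    then have "(\<Prod>i\<in>I. y) \<le> (\<Prod>i\<in>I. expect ?p V (\<lambda>R. of_bool (\<not> generated (G i) R)))"
      using t e by (intro prod_mono) (auto simp: y_def)
    then show ?thesis by (simp add: s_def)
  qed
  also have "\<dots> \<le> expect ?p V (\<lambda>R. \<Prod>i\<in>I. of_bool (\<not> generated (G i) R))"
  proof (rule expect_prod_antimono[OF assms(1) _ _ assms(2)])
    show "of_bool (\<not> generated (G i) B) \<le> (of_bool (\<not> generated (G i) A) :: real)" if "A \<subseteq> B" for i A B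
      using generated_mono[OF that, of "G i"] by auto
  qed (use t in \<open>auto simp: power_le_one\<close>)
  also have "\<dots> = expect ?p V (\<lambda>R. of_bool (P R))"
    using assms(2) by (intro expect_cong) (auto simp: P_def)
  also have "\<dots> = (\<Sum>j\<le>m + s. d j * (?p ^ j * t ^ (m + s - j)))"
    using expect_by_card[OF assms(1), of ?p P] by (simp add: n d_def t)
  \<comment> \<open>From level \<open>k\<close> on, \<open>d j\<close> is at most
    \<open>m choose j\<close>; below \<open>k\<close> all sets are allowed, and the excess is split
    off.\<close>
  also have "\<dots> \<le> (\<Sum>j\<le>m + s. (m choose j) * (?p ^ j * t ^ (m + s - j))
      + of_bool (j < k) * (real (m + s choose j) - real (m choose j)) * (?p ^ j * t ^ (m + s - j)))"
  proof (rule sum_mono)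
    fix j
    have "d j \<le> card (nsets V j)"
      unfolding d_def using finite_imp_finite_nsets[OF assms(1)] by (intro card_mono) auto
    moreover have "d j \<le> m choose j" if "k \<le> j"
      unfolding d_def
    proof (rule card_down_closed_le_binomial[OF assms(1) _ dk _ that])
      show "P R" if "R \<subseteq> S" "P S" for R S
        using that generated_mono unfolding P_def by blast
    qed (use k in simp)
    ultimately have "real (d j) \<le> (m choose j)
        + of_bool (j < k) * (real (m + s choose j) - real (m choose j))"
      using n by (cases "j < k") auto
    then have "real (d j) * (?p ^ j * t ^ (m + s - j)) \<le> ((m choose j)
        + of_bool (j < k) * (real (m + s choose j) - real (m choose j))) * (?p ^ j * t ^ (m + s - j))"
      using t by (intro mult_right_mono) auto
    then show "real (d j) * (?p ^ j * t ^ (m + s - j)) \<le> (m choose j) * (?p ^ j * t ^ (m + s - j))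
        + of_bool (j < k) * (real (m + s choose j) - real (m choose j)) * (?p ^ j * t ^ (m + s - j))"
      by (simp add: distrib_right)
  qed
  also have "\<dots> = t ^ s + (\<Sum>j\<le>m + s. of_bool (j < k) * (real (m + s choose j) - real (m choose j))
      * (?p ^ j * t ^ (m + s - j)))" (is "_ = _ + ?L")
  proof -
    have "?p + t = 1" using t by simp
    then show ?thesis by (simp add: sum.distrib binomial_sum_shift)
  qed
  finally have le: "y ^ s - t ^ s \<le> ?L" by simp
  \<comment> \<open>Chernoff-type weighting: \<open>e\<^sup>k\<^sup>-\<^sup>1 \<le> e\<^sup>j\<close> on the levels \<open>j < k\<close>, after which the sum over
    all levels is evaluated by the binomial theorem.\<close>
  have "e ^ (k - 1) * ?L \<le> (\<Sum>j\<le>m + s. (real (m + s choose j) - real (m choose j))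
      * ((?p * e) ^ j * t ^ (m + s - j)))"
    unfolding sum_distrib_left
  proof (rule sum_mono)
    fix j
    let ?c = "real (m + s choose j) - real (m choose j)"
    have c: "0 \<le> ?c" by (simp add: binomial_right_mono)
    have "of_bool (j < k) * e ^ (k - 1) \<le> e ^ j"
      using e by (auto intro: power_decreasing)
    then have "(of_bool (j < k) * e ^ (k - 1)) * (?c * (?p ^ j * t ^ (m + s - j)))
        \<le> e ^ j * (?c * (?p ^ j * t ^ (m + s - j)))"
      using c t by (intro mult_right_mono) auto
    then show "e ^ (k - 1) * (of_bool (j < k) * ?c * (?p ^ j * t ^ (m + s - j)))
        \<le> ?c * ((?p * e) ^ j * t ^ (m + s - j))"
      by (simp add: power_mult_distrib mult_ac)
  qed
  \<comment> \<open>Since \<open>?p * e + t = y\<close>, the weight \<open>e\<close> produces the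
    same difference \<open>y ^ s - t ^ s\<close> as the lower bound.\<close>
  also have "\<dots> = y ^ (m + s) - t ^ s * y ^ m"
    using binomial_sum_shift[where m = "m + s" and s = 0 and a = "?p * e" and b = t]
      binomial_sum_shift[where m = m and s = s and a = "?p * e" and b = t]
    by (simp add: left_diff_distrib sum_subtractf y_def add.commute)
  also have "\<dots> = y ^ m * (y ^ s - t ^ s)" by (simp add: power_add algebra_simps)
  also have "\<dots> < e ^ (k - 1) * (y ^ s - t ^ s)"
  proof (rule mult_strict_right_mono)
    show "y ^ m < e ^ (k - 1)"
      using golden_power_less[OF k m] by (simp add: y_def e_def t_def)
    have "t < y" using t e by (simp add: y_def)
    then have "t ^ s < y ^ s" using s t by (intro power_strict_mono) auto
    then show "0 < y ^ s - t ^ s" by simp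
  qed
  also have "\<dots> \<le> e ^ (k - 1) * ?L" using le e by (intro mult_left_mono) auto
  finally show False by simp
qed

section \<open>Deletion of centres and the equality case\<close>

text \<open>Induction on the number of families. The non-trivial case is strict, so equality forces
  a centre at every stage, and the deleted centres form \<open>X\<close>.\<close>

lemma uncovered_by_intersecting:
  assumes "finite V" "finite I"
    and "\<And>i. i \<in> I \<Longrightarrow> G i \<subseteq> nsets V k" "\<And>i. i \<in> I \<Longrightarrow> intersecting (G i)"
    and "2 * k\<^sup>2 + 1 + card I \<le> card V"
  defines "U \<equiv> {B \<in> nsets V k. \<forall>i\<in>I. B \<notin> G i}"
  shows "(card V - card I) choose k \<le> card U"
    and "card U = (card V - card I) choose k \<Longrightarrow> \<exists>X\<subseteq>V. card X = card I \<and> U = nsets (V - X) k"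
proof -
  have "(card V - card I) choose k \<le> card U \<and>
      (card U = (card V - card I) choose k \<longrightarrow> (\<exists>X\<subseteq>V. card X = card I \<and> U = nsets (V - X) k))"
    using assms(1-5) unfolding U_def
  proof (induction "card I" arbitrary: V I G)
    case 0
    then have "I = {}" by simp
    then show ?case by (auto intro!: exI[of _ "{}"])
  next
    case (Suc s)
    let ?U = "{B \<in> nsets V k. \<forall>i\<in>I. B \<notin> G i}"
    have "I \<noteq> {}" using Suc.hyps(2) by auto
    show ?case
    proof (cases "\<forall>i\<in>I. \<forall>x\<in>V. \<exists>A\<in>G i. x \<notin> A")
      case True
      then have "(card V - card I) choose k < card ?U"
        using Suc.prems \<open>I \<noteq> {}\<close> by (intro uncovered_nontrivial) auto
      then show ?thesis by simp
    next
      case False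
      \<comment> \<open>An empty \<open>G i\<close> also falls under this case, with any
        \<open>x\<close> in \<open>V\<close>.\<close>
      then obtain i x where ix: "i \<in> I" "x \<in> V" "\<And>A. A \<in> G i \<Longrightarrow> x \<in> A" by blast
      define W where "W = V - {x}"
      define J where "J = I - {i}"
      define H where "H j = {A \<in> G j. x \<notin> A}" for j
      let ?U' = "{B \<in> nsets W k. \<forall>j\<in>J. B \<notin> H j}"
      have J: "s = card J" using Suc.hyps(2) ix(1) Suc.prems(2) by (simp add: J_def)
      have W: "Suc (card W) = card V" unfolding W_def by (rule card_Suc_Diff1[OF Suc.prems(1) ix(2)])
      have eq: "card W - card J = card V - card I" using J W Suc.hyps(2) by simp
      have IH: "(card W - card J) choose k \<le> card ?U' \<and>
          (card ?U' = (card W - card J) choose k \<longrightarrow>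
            (\<exists>X\<subseteq>W. card X = card J \<and> ?U' = nsets (W - X) k))"
      proof (rule Suc.hyps(1)[OF J])
        fix j assume "j \<in> J"
        then have j: "G j \<subseteq> nsets V k" "intersecting (G j)" using Suc.prems by (auto simp: J_def)
        show "H j \<subseteq> nsets W k" using j(1) by (fastforce simp: H_def W_def nsets_def)
        show "intersecting (H j)" using j(2) by (simp add: H_def intersecting_def)
      qed (use Suc.prems J W Suc.hyps(2) in \<open>auto simp: W_def J_def\<close>)
      \<comment> \<open>A set avoiding \<open>x\<close> cannot lie in \<open>G i\<close>, and it
        lies in \<open>H j\<close> exactly when it lies in \<open>G j\<close>.\<close>
      have sub: "?U' \<subseteq> ?U"
        using ix by (fastforce simp: W_def J_def H_def nsets_def)
      have fin: "finite ?U" using finite_imp_finite_nsets[OF Suc.prems(1)] by simp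
      have le: "card ?U' \<le> card ?U" using sub fin by (rule card_mono[rotated])
      show ?thesis
      proof (intro conjI impI)
        show "(card V - card I) choose k \<le> card ?U" using IH le eq by simp
        assume "card ?U = (card V - card I) choose k"
        then have card_eq: "card ?U' = card ?U" using IH le eq by simp
        then have U: "?U' = ?U" using sub fin by (intro card_subset_eq) auto
        obtain X where X: "X \<subseteq> W" "card X = card J" "?U' = nsets (W - X) k"
          using IH card_eq \<open>card ?U = _\<close> eq by auto
        have "X \<subseteq> V" "x \<notin> X" using X(1) by (auto simp: W_def)
        then have "finite X" using finite_subset Suc.prems(1) by blast
        then have "card (insert x X) = card I" using \<open>x \<notin> X\<close> X(2) J Suc.hyps(2) by simp
        moreover have "W - X = V - insert x X" by (auto simp: W_def)
        then have "?U = nsets (V - insert x X) k" using U X(3) by simp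
        moreover have "insert x X \<subseteq> V" using X(1) ix(2) by (auto simp: W_def)
        ultimately show "\<exists>X\<subseteq>V. card X = card I \<and> ?U = nsets (V - X) k" by blast
      qed
    qed
  qed
  then show "(card V - card I) choose k \<le> card U"
    and "card U = (card V - card I) choose k \<Longrightarrow> \<exists>X\<subseteq>V. card X = card I \<and> U = nsets (V - X) k"
    by auto
qed

theorem theorem2:
  fixes \<epsilon> :: real
  assumes "\<epsilon> > 0"
  shows "\<exists>n0 :: nat. \<forall>n k s :: nat.
           n \<ge> n0 \<longrightarrow> s \<ge> 1 \<longrightarrow> real n > (2 + \<epsilon>) * (real k)\<^sup>2 + real s \<longrightarrow>
           (\<forall>F. F \<subseteq> nsets {1..n} k \<longrightarrow> union_of_intersecting s F \<longrightarrow>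
              card F \<le> (n choose k) - ((n - s) choose k) \<and>
              (card F = (n choose k) - ((n - s) choose k) \<longrightarrow> union_of_stars n k s F))"
proof (intro exI[of _ 0] allI impI)
  fix n k s :: nat and F :: "nat set set"
  assume n: "real n > (2 + \<epsilon>) * (real k)\<^sup>2 + real s"
    and F: "F \<subseteq> nsets {1..n} k" and "union_of_intersecting s F"
  then obtain G :: "nat \<Rightarrow> nat set set" where
    G: "\<And>i. i \<in> {1..s} \<Longrightarrow> intersecting (G i)" "F = (\<Union>i\<in>{1..s}. G i)"
    unfolding union_of_intersecting_def by blast
  \<comment> \<open>This yields \<open>2 * k\<^sup>2 + s < n\<close> for every \<open>n\<close>,
    which is why \<open>0\<close> serves as the threshold.\<close>
  have "0 \<le> \<epsilon> * (real k)\<^sup>2" using assms by simp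
  then have "real (2 * k\<^sup>2 + s) < real n" using n by (simp add: distrib_right)
  then have "2 * k\<^sup>2 + s < n" by (simp only: of_nat_less_iff)
  then have card: "2 * k\<^sup>2 + 1 + card {1..s} \<le> card {1..n}" by simp
  define U where "U = nsets {1..n} k - F"
  have U: "{B \<in> nsets {1..n} k. \<forall>i\<in>{1..s}. B \<notin> G i} = U" using G(2) by (auto simp: U_def)
  have sub: "\<And>i. i \<in> {1..s} \<Longrightarrow> G i \<subseteq> nsets {1..n} k" using F G(2) by blast
  note unc = uncovered_by_intersecting[of "{1..n}" "{1..s}" G k,
      OF finite_atLeastAtMost finite_atLeastAtMost sub G(1) card,
      unfolded U card_atLeastAtMost diff_Suc_1]
  have fin: "finite (nsets {1..n} k)" by (simp add: finite_imp_finite_nsets)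
  have cardU: "card U + card F = n choose k"
    using card_Diff_subset[OF finite_subset[OF F fin] F] card_mono[OF fin F] by (simp add: U_def)
  show "card F \<le> (n choose k) - ((n - s) choose k) \<and>
      (card F = (n choose k) - ((n - s) choose k) \<longrightarrow> union_of_stars n k s F)"
  proof (intro conjI impI)
    show "card F \<le> (n choose k) - ((n - s) choose k)" using unc(1) cardU by simp
    assume "card F = (n choose k) - ((n - s) choose k)"
    moreover have "(n - s) choose k \<le> n choose k" by (simp add: binomial_right_mono)
    ultimately have "card U = (n - s) choose k" using cardU by simp
    then obtain X where X: "X \<subseteq> {1..n}" "card X = s" "U = nsets ({1..n} - X) k"
      using unc(2) by blast
    then obtain x where x: "bij_betw x {1..s} X"
      using ex_bij_betw_nat_finite_1 finite_subset by blast
    \<comment> \<open>The uncovered sets are those avoiding \<open>X\<close>, so \<open>F\<close>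
      consists of the sets meeting \<open>X\<close>, and the points of \<open>X\<close> are the
      centres.\<close>
    have "F = nsets {1..n} k - U" using F by (auto simp: U_def)
    also have "\<dots> = {A \<in> nsets {1..n} k. A \<inter> X \<noteq> {}}" unfolding X(3) by (auto simp: nsets_def)
    also have "\<dots> = (\<Union>i\<in>{1..s}. star n k (x i))"
      using bij_betw_imp_surj_on[OF x] by (auto simp: star_def)
    finally show "union_of_stars n k s F"
      unfolding union_of_stars_def using x X(1) by (auto simp: bij_betw_def)
  qed
qed

end
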